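(* Let $A\in\mathbb{R}^{m\times n}$, $b\in\mathbb{R}^m$, $u\in\mathbb{R}^n$, $\tau>0$, and let $\mathcal{X}=I_1\times\cdots\times I_n\subset\mathbb{R}^n$ with $I_i\in T_1\cup T_2$ for every $i$ be such that $\mathcal{X}\cap\{x: Ax=b\}\neq\emptyset$. Consider the iteration $$x^{k+1}=[\tau\cdot\mathrm{shrink}(\tau^{-1}u+A^Ty^{k})]_{\mathcal{X}}^+,\qquad y^{k+1}=y^{k}+h\,(b-Ax^{k+1}),\qquad k=0,1,2,\dots$$ with step size $h\in\left(0,\frac{2}{\tau\|A\|^2}\right)$ and $y^0=0$. Let $x^*$ be the unique minimizer of the problem $$\min_{x}\ \|x\|_1+\frac{1}{2\tau}\|x-u\|_2^2\quad\text{s.t. } Ax=b,\ x\in\mathcal{X},$$ and let $\mathcal{Y}$ be the solution set of its Lagrange dual problem $\max_{y\in\mathbb{R}^m}D(y)$. Then $\lim_{k\to+\infty}x^k=x^*$, and there exists a point $\bar{y}\in\mathcal{Y}$ such that $\lim_{k\to+\infty}y^k=\bar{y}$.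
   Context: $T_1$ is the class of intervals of one of the forms $[c,\infty)$ with $c>0$; $(-\infty,c]$ with $c<0$; $[c,d]$ with $0<c<d$; $[d,c]$ with $d<c<0$. $T_2$ is the class of intervals $[c,d]$ with $c<0<d$. For a nonempty closed convex set $\mathcal{X}$, $[x]_{\mathcal{X}}^+=\arg\min_{y\in\mathcal{X}}\|x-y\|_2$ is the Euclidean projection of $x$ onto $\mathcal{X}$. The shrinkage operator is $\mathrm{shrink}(s)=\mathrm{sign}(s)\max\{|s|-1,0\}$ for $s\in\mathbb{R}$, applied componentwise to vectors. For the box $\mathcal{X}$, the projection acts componentwise, so $\left([\tau\cdot\mathrm{shrink}(v)]_{\mathcal{X}}^+\right)_i=[\tau\cdot\mathrm{shrink}(v_i)]_{I_i}^+$. $\|A\|$ is the spectral (operator 2-) norm of $A$. The Lagrangian is $L(x,y)=\|x\|_1+\frac{1}{2\tau}\|x-u\|_2^2+\langle y,b-Ax\rangle$, and the Lagrange dual function is $D(y)=\min_{x\in\mathcal{X}}L(x,y)$ for $y\in\mathbb{R}^m$. *)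

theory Defs
  imports "HOL-Analysis.Analysis"
begin

definition T1 :: "real set set" where
  "T1 = {{c..} | c. c > 0} \<union> {{..c} | c. c < 0}
      \<union> {{c..d} | c d. 0 < c \<and> c < d} \<union> {{d..c} | c d. d < c \<and> c < 0}"

definition T2 :: "real set set" where
  "T2 = {{c..d} | c d. c < 0 \<and> 0 < d}"

definition box_of :: "('n \<Rightarrow> real set) \<Rightarrow> (real ^ 'n) set" where
  "box_of I = {x. \<forall>i. x $ i \<in> I i}"

definition shrink :: "real \<Rightarrow> real" where
  "shrink s = sgn s * max (\<bar>s\<bar> - 1) 0"

definition vshrink :: "real ^ 'n \<Rightarrow> real ^ 'n" where
  "vshrink v = (\<chi> i. shrink (v $ i))"

definition l1_norm :: "real ^ 'n \<Rightarrow> real" where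
  "l1_norm x = (\<Sum>i\<in>UNIV. \<bar>x $ i\<bar>)"

definition primal_obj :: "real \<Rightarrow> real ^ 'n \<Rightarrow> real ^ 'n \<Rightarrow> real" where
  "primal_obj \<tau> u x = l1_norm x + 1 / (2 * \<tau>) * (norm (x - u))\<^sup>2"

definition lagrangian ::
    "real ^ 'n ^ 'm \<Rightarrow> real ^ 'm \<Rightarrow> real ^ 'n \<Rightarrow> real \<Rightarrow> real ^ 'n \<Rightarrow> real ^ 'm \<Rightarrow> real" where
  "lagrangian A b u \<tau> x y = l1_norm x + 1 / (2 * \<tau>) * (norm (x - u))\<^sup>2 + y \<bullet> (b - A *v x)"

text \<open>The infimum below is a minimum for a nonempty closed convex set and positive \<open>\<tau>\<close>:
  see \<open>dual_fun_attained\<close>.\<close>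

definition dual_fun ::
    "real ^ 'n ^ 'm \<Rightarrow> real ^ 'm \<Rightarrow> real ^ 'n \<Rightarrow> real \<Rightarrow> (real ^ 'n) set \<Rightarrow> real ^ 'm \<Rightarrow> real" where
  "dual_fun A b u \<tau> X y = (INF x\<in>X. lagrangian A b u \<tau> x y)"

definition dual_solutions ::
    "real ^ 'n ^ 'm \<Rightarrow> real ^ 'm \<Rightarrow> real ^ 'n \<Rightarrow> real \<Rightarrow> (real ^ 'n) set \<Rightarrow> (real ^ 'm) set" where
  "dual_solutions A b u \<tau> X = {y. \<forall>z. dual_fun A b u \<tau> X z \<le> dual_fun A b u \<tau> X y}"

lemma continuous_on_lagrangian:
  "continuous_on S (\<lambda>x. lagrangian A b u \<tau> x y)"
  unfolding lagrangian_def l1_norm_def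
  by (intro continuous_intros linear_continuous_on matrix_vector_mul_bounded_linear)

lemma lagrangian_lower_bound:
  assumes "\<tau> > 0"
  shows "lagrangian A b u \<tau> x y \<ge>
    1 / (2 * \<tau>) * (norm (x - (u + \<tau> *\<^sub>R (transpose A *v y))))\<^sup>2
      + (y \<bullet> b - (transpose A *v y) \<bullet> u - \<tau> / 2 * (norm (transpose A *v y))\<^sup>2)"
proof -
  let ?w = "transpose A *v y"
  have dot: "y \<bullet> (A *v x) = ?w \<bullet> x"
    by (simp add: dot_lmul_matrix)
  have "(norm (x - (u + \<tau> *\<^sub>R w)))\<^sup>2
      = (norm (x - u))\<^sup>2 - 2 * \<tau> * (w \<bullet> x - w \<bullet> u) + \<tau>\<^sup>2 * (norm w)\<^sup>2" for w
    unfolding power2_norm_eq_inner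
    by (simp add: inner_simps inner_commute algebra_simps power2_eq_square)
  from this[of ?w] have "1 / (2 * \<tau>) * (norm (x - (u + \<tau> *\<^sub>R ?w)))\<^sup>2
      = 1 / (2 * \<tau>) * (norm (x - u))\<^sup>2 - (?w \<bullet> x - ?w \<bullet> u) + \<tau> / 2 * (norm ?w)\<^sup>2"
    using assms by (simp add: field_simps power2_eq_square del: transpose_matrix_vector)
  moreover have "l1_norm x \<ge> 0"
    by (simp add: l1_norm_def sum_nonneg)
  ultimately show ?thesis
    by (simp add: lagrangian_def inner_diff_right dot)
qed

lemma lagrangian_midpoint:
  assumes "\<tau> > 0" and "x \<noteq> z"
  shows "lagrangian A b u \<tau> ((1/2) *\<^sub>R (x + z)) y
    < (lagrangian A b u \<tau> x y + lagrangian A b u \<tau> z y) / 2"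
proof -
  let ?p = "(1/2) *\<^sub>R (x + z)"
  have l1: "l1_norm ?p \<le> (l1_norm x + l1_norm z) / 2"
    unfolding l1_norm_def sum.distrib[symmetric] sum_divide_distrib
    by (intro sum_mono) auto
  have "(norm (?p - u))\<^sup>2
      = ((norm (x - u))\<^sup>2 + (norm (z - u))\<^sup>2) / 2 - (norm (x - z))\<^sup>2 / 4"
    by (simp add: power2_norm_eq_inner inner_simps inner_commute algebra_simps field_simps)
  moreover have "(norm (x - z))\<^sup>2 > 0"
    using assms(2) by simp
  ultimately have "(norm (?p - u))\<^sup>2 < ((norm (x - u))\<^sup>2 + (norm (z - u))\<^sup>2) / 2"
    by linarith
  then have "1 / (2 * \<tau>) * (norm (?p - u))\<^sup>2
      < 1 / (2 * \<tau>) * (((norm (x - u))\<^sup>2 + (norm (z - u))\<^sup>2) / 2)"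
    using assms by (intro mult_strict_left_mono) auto
  also have "\<dots> = (1 / (2 * \<tau>) * (norm (x - u))\<^sup>2 + 1 / (2 * \<tau>) * (norm (z - u))\<^sup>2) / 2"
    using assms by (simp add: field_simps)
  finally have sq: "1 / (2 * \<tau>) * (norm (?p - u))\<^sup>2
      < (1 / (2 * \<tau>) * (norm (x - u))\<^sup>2 + 1 / (2 * \<tau>) * (norm (z - u))\<^sup>2) / 2" .
  have lin: "y \<bullet> (b - A *v ?p) = (y \<bullet> (b - A *v x) + y \<bullet> (b - A *v z)) / 2"
    by (simp add: matrix_vector_mult_scaleR matrix_vector_right_distrib inner_simps field_simps)
  have combine: "p + q + r < (p1 + q1 + r1 + (p2 + q2 + r2)) / 2"
    if "p \<le> (p1 + p2) / 2" "q < (q1 + q2) / 2" "r = (r1 + r2) / 2" for p q r p1 q1 r1 p2 q2 r2 :: real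
    using that by (simp add: field_simps)
  show ?thesis
    unfolding lagrangian_def by (rule combine[OF l1 sq lin])
qed

lemma lagrangian_ex1_minimizer:
  assumes "\<tau> > 0" "closed S" "convex S" "S \<noteq> {}"
  shows "\<exists>!x. x \<in> S \<and> (\<forall>z\<in>S. lagrangian A b u \<tau> x y \<le> lagrangian A b u \<tau> z y)"
proof (rule ex_ex1I)
  let ?L = "\<lambda>x. lagrangian A b u \<tau> x y"
  define w where "w = u + \<tau> *\<^sub>R (transpose A *v y)"
  define c where
    "c = y \<bullet> b - (transpose A *v y) \<bullet> u - \<tau> / 2 * (norm (transpose A *v y))\<^sup>2"
  have lower: "1 / (2 * \<tau>) * (norm (x - w))\<^sup>2 + c \<le> ?L x" for x
    using lagrangian_lower_bound[OF assms(1)] unfolding w_def c_def by blast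
  obtain x0 where x0: "x0 \<in> S" using assms(4) by blast
  define r where "r = sqrt (2 * \<tau> * (?L x0 - c))"
  have in_ball: "z \<in> cball w r" if "?L z \<le> ?L x0" for z
  proof -
    have "1 / (2 * \<tau>) * (norm (z - w))\<^sup>2 \<le> ?L x0 - c"
      using lower[of z] that by linarith
    then have "(norm (z - w))\<^sup>2 \<le> 2 * \<tau> * (?L x0 - c)"
      using assms(1) by (simp add: field_simps)
    then show ?thesis
      unfolding r_def by (simp add: real_le_rsqrt dist_norm norm_minus_commute)
  qed
  have "compact (S \<inter> cball w r)"
    using assms(2) by (simp add: closed_Int_compact)
  moreover have "S \<inter> cball w r \<noteq> {}"
    using x0 in_ball[of x0] by auto
  ultimately obtain p where p: "p \<in> S \<inter> cball w r"
    and pmin: "\<And>z. z \<in> S \<inter> cball w r \<Longrightarrow> ?L p \<le> ?L z"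
    using continuous_attains_inf[OF _ _ continuous_on_lagrangian] by metis
  have "?L p \<le> ?L z" if "z \<in> S" for z
  proof (cases "?L z \<le> ?L x0")
    case True
    then show ?thesis using pmin in_ball that by blast
  next
    case False
    have "?L p \<le> ?L x0" using pmin in_ball x0 by blast
    with False show ?thesis by linarith
  qed
  then show "\<exists>x. x \<in> S \<and> (\<forall>z\<in>S. ?L x \<le> ?L z)"
    using p by blast
next
  fix p q
  assume p: "p \<in> S \<and> (\<forall>z\<in>S. lagrangian A b u \<tau> p y \<le> lagrangian A b u \<tau> z y)"
    and q: "q \<in> S \<and> (\<forall>z\<in>S. lagrangian A b u \<tau> q y \<le> lagrangian A b u \<tau> z y)"
  show "p = q"
  proof (rule ccontr)
    assume "p \<noteq> q"
    have "(1/2) *\<^sub>R (p + q) \<in> S"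
      using p q assms(3) convexD[of S p q "1/2" "1/2"] by (simp add: scaleR_add_right)
    then show False
      using p q lagrangian_midpoint[OF assms(1) \<open>p \<noteq> q\<close>, of A b u y] by fastforce
  qed
qed

lemma dual_fun_attained:
  assumes "\<tau> > 0" "closed X" "convex X" "X \<noteq> {}"
  shows "\<exists>x\<in>X. dual_fun A b u \<tau> X y = lagrangian A b u \<tau> x y
    \<and> (\<forall>z\<in>X. lagrangian A b u \<tau> x y \<le> lagrangian A b u \<tau> z y)"
proof -
  obtain p where p: "p \<in> X" "\<And>z. z \<in> X \<Longrightarrow> lagrangian A b u \<tau> p y \<le> lagrangian A b u \<tau> z y"
    using lagrangian_ex1_minimizer[OF assms] by blast
  then have "dual_fun A b u \<tau> X y = lagrangian A b u \<tau> p y"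
    unfolding dual_fun_def by (intro cInf_eq_minimum) auto
  with p show ?thesis by blast
qed

lemma closed_convex_box_of:
  assumes "\<forall>i. I i \<in> T1 \<union> T2"
  shows "closed (box_of I)" and "convex (box_of I)"
proof -
  have I: "closed (I i) \<and> convex (I i)" for i
    using assms[rule_format, of i]
    by (auto simp: T1_def T2_def closed_real_atLeast convex_real_interval)
  have box: "box_of I = (\<Inter>i. (\<lambda>x. x $ i) -` I i)"
    by (auto simp: box_of_def)
  show "closed (box_of I)"
    unfolding box using I
    by (intro closed_INT ballI closed_vimage continuous_on_component) (auto intro: continuous_intros)
  show "convex (box_of I)"
    unfolding box using I
    by (intro convex_INT convex_linear_vimage) (auto simp: linear_iff)
qed

lemma primal_ex1_minimizer:
  fixes A :: "real ^ 'n ^ 'm"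
  assumes "\<tau> > 0" "\<forall>i. I i \<in> T1 \<union> T2" "box_of I \<inter> {x. A *v x = b} \<noteq> {}"
  shows "\<exists>!x. is_arg_min (primal_obj \<tau> u) (\<lambda>x. A *v x = b \<and> x \<in> box_of I) x"
proof -
  let ?S = "box_of I \<inter> {x. A *v x = b}"
  have "closed {x. A *v x = b}"
    by (intro closed_Collect_eq continuous_intros linear_continuous_on
        matrix_vector_mul_bounded_linear)
  moreover have "convex {x. A *v x = b}"
    by (auto simp: convex_def matrix_vector_right_distrib matrix_vector_mult_scaleR
        simp flip: scaleR_add_left)
  ultimately have "closed ?S" "convex ?S"
    using closed_convex_box_of[OF assms(2)] by (auto intro: convex_Int)
  moreover have "primal_obj \<tau> u = (\<lambda>x. lagrangian A b u \<tau> x 0)"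
    by (auto simp: primal_obj_def lagrangian_def)
  ultimately show ?thesis
    using lagrangian_ex1_minimizer[OF assms(1) _ _ assms(3), of A b u 0]
    unfolding is_arg_min_linorder by (simp add: Ball_def conj_ac)
qed

end

theory Submission
  imports Defs
begin

text \<open>
  Componentwise, shrinking and projecting yields the minimizer over \<open>X\<close> of the strongly convex
  Lagrangian \<open>L(\<cdot>, y)\<close>, so the iteration is gradient ascent on the dual function. Strong convexity
  makes \<open>y \<mapsto> A x(y)\<close> cocoercive. Hence, for every multiplier \<open>z\<close>, that is, every \<open>z\<close> for which \<open>x\<^sup>*\<close>
  minimizes \<open>L(\<cdot>, z)\<close>,
  \<open>\<parallel>y\<^sup>k\<^sup>+\<^sup>1 - z\<parallel>\<^sup>2 + (2 h / \<tau> - h\<^sup>2 \<parallel>A\<parallel>\<^sup>2) \<parallel>x\<^sup>k\<^sup>+\<^sup>1 - x\<^sup>*\<parallel>\<^sup>2 \<le> \<parallel>y\<^sup>k - z\<parallel>\<^sup>2\<close>.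
  This forces \<open>x\<^sup>k \<rightarrow> x\<^sup>*\<close>; every cluster point of \<open>y\<^sup>k\<close> is then again a multiplier, and Fejer monotonicity
  with respect to it gives convergence of the whole sequence.

  No Slater condition is assumed, so a multiplier is obtained from polyhedrality: the finitely many
  vectors (image of a feasible axis direction, slope of the objective along it) generate a closed
  cone, which misses \<open>(0, -1)\<close> because \<open>x\<^sup>*\<close> is optimal; a separating functional is the multiplier.
\<close>

section \<open>Separation and the cone of feasible directions at the minimizer\<close>

text \<open>Strict separation yields a bound \<open>\<beta>\<close>, negative because
  \<open>0\<close> lies in the cone. A cone element with negative value could be rescaled to have
  value exactly \<open>\<beta>\<close>, contradicting strictness.\<close>

lemma convex_cone_separation:
  fixes K :: "'a::euclidean_space set"
  assumes K: "convex_cone K" "closed K" and "p \<notin> K"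
  obtains a where "a \<bullet> p < 0" "\<And>k. k \<in> K \<Longrightarrow> 0 \<le> a \<bullet> k"
proof -
  have "convex K" using K by (simp add: convex_cone_def)
  then obtain a \<beta> where a: "a \<bullet> p < \<beta>" "\<And>k. k \<in> K \<Longrightarrow> \<beta> < a \<bullet> k"
    using separating_hyperplane_closed_point[of K p] K \<open>p \<notin> K\<close> by blast
  have "\<beta> < 0" using a(2)[OF convex_cone_contains_0[OF K(1)]] by simp
  have "0 \<le> a \<bullet> k" if "k \<in> K" for k
  proof (rule ccontr)
    assume "\<not> 0 \<le> a \<bullet> k"
    then have neg: "a \<bullet> k < 0" by simp
    then have "(\<beta> / (a \<bullet> k)) *\<^sub>R k \<in> K"
      using K(1) that \<open>\<beta> < 0\<close> by (intro convex_cone_scaleR) (auto intro: divide_nonpos_nonpos)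
    from a(2)[OF this] neg show False by simp
  qed
  then show ?thesis using that a(1) \<open>\<beta> < 0\<close> by force
qed

text \<open>The objective is the Lagrangian with zero data and zero multiplier, so this is the weak
  form of \<open>lagrangian_midpoint\<close>, which excludes \<open>x = z\<close>.\<close>

lemma primal_obj_midpoint:
  assumes "\<tau> > 0"
  shows "primal_obj \<tau> u ((1/2) *\<^sub>R (x + z)) \<le> (primal_obj \<tau> u x + primal_obj \<tau> u z) / 2"
proof (cases "x = z")
  case True
  then have "(1/2) *\<^sub>R (x + z) = x" by (simp flip: scaleR_2)
  with True show ?thesis by simp
next
  case False
  from lagrangian_midpoint[OF assms this, of 0 0 u 0] show ?thesis
    by (simp add: lagrangian_def primal_obj_def)
qed

text \<open>The second component \<open>s\<close> bounds the slope of the objective along \<open>d\<close>. Allowing an error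
  \<open>C \<epsilon>\<^sup>2\<close> makes this a convex cone by midpoint convexity alone, without directional derivatives.\<close>

definition descent_cone ::
    "real ^ 'n ^ 'm \<Rightarrow> real \<Rightarrow> real ^ 'n \<Rightarrow> (real ^ 'n) set \<Rightarrow> real ^ 'n \<Rightarrow> ((real ^ 'm) \<times> real) set" where
  "descent_cone A \<tau> u X p = {(v, s). \<exists>d C e. A *v d = v \<and> C \<ge> 0 \<and> e > 0 \<and>
     (\<forall>\<epsilon>. 0 \<le> \<epsilon> \<and> \<epsilon> \<le> e \<longrightarrow> p + \<epsilon> *\<^sub>R d \<in> X \<and>
        primal_obj \<tau> u (p + \<epsilon> *\<^sub>R d) \<le> primal_obj \<tau> u p + \<epsilon> * s + C * \<epsilon>\<^sup>2)}"

lemma descent_coneI: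
  assumes "A *v d = v" "C \<ge> 0" "e > 0"
    and "\<And>\<epsilon>. 0 \<le> \<epsilon> \<Longrightarrow> \<epsilon> \<le> e \<Longrightarrow> p + \<epsilon> *\<^sub>R d \<in> X"
    and "\<And>\<epsilon>. 0 \<le> \<epsilon> \<Longrightarrow> \<epsilon> \<le> e \<Longrightarrow>
      primal_obj \<tau> u (p + \<epsilon> *\<^sub>R d) \<le> primal_obj \<tau> u p + \<epsilon> * s + C * \<epsilon>\<^sup>2"
  shows "(v, s) \<in> descent_cone A \<tau> u X p"
  using assms unfolding descent_cone_def by blast

lemma descent_coneE:
  assumes "k \<in> descent_cone A \<tau> u X p"
  obtains d s C e where "k = (A *v d, s)" "C \<ge> 0" "e > 0"
    and "\<And>\<epsilon>. 0 \<le> \<epsilon> \<Longrightarrow> \<epsilon> \<le> e \<Longrightarrow> p + \<epsilon> *\<^sub>R d \<in> X"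
    and "\<And>\<epsilon>. 0 \<le> \<epsilon> \<Longrightarrow> \<epsilon> \<le> e \<Longrightarrow>
      primal_obj \<tau> u (p + \<epsilon> *\<^sub>R d) \<le> primal_obj \<tau> u p + \<epsilon> * s + C * \<epsilon>\<^sup>2"
  using assms unfolding descent_cone_def by blast

lemma convex_cone_descent_cone:
  fixes A :: "real ^ 'n ^ 'm"
  assumes "\<tau> > 0" "convex X" "p \<in> X"
  shows "convex_cone (descent_cone A \<tau> u X p)"
  unfolding convex_cone_iff
proof (intro conjI ballI allI impI)
  let ?F = "primal_obj \<tau> u"
  have "(0::real ^ 'm, 0::real) \<in> descent_cone A \<tau> u X p"
    by (rule descent_coneI[where d = 0 and C = 0 and e = 1]) (use assms in auto)
  then show zero: "0 \<in> descent_cone A \<tau> u X p" by (simp add: zero_prod_def)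
  show "k + l \<in> descent_cone A \<tau> u X p"
    if "k \<in> descent_cone A \<tau> u X p" "l \<in> descent_cone A \<tau> u X p" for k l
  proof -
    from that(1) obtain d s C e where k: "k = (A *v d, s)" "C \<ge> 0" "e > 0"
      "\<And>\<epsilon>. 0 \<le> \<epsilon> \<Longrightarrow> \<epsilon> \<le> e \<Longrightarrow> p + \<epsilon> *\<^sub>R d \<in> X"
      "\<And>\<epsilon>. 0 \<le> \<epsilon> \<Longrightarrow> \<epsilon> \<le> e \<Longrightarrow> ?F (p + \<epsilon> *\<^sub>R d) \<le> ?F p + \<epsilon> * s + C * \<epsilon>\<^sup>2"
      by (rule descent_coneE) blast
    from that(2) obtain d' s' C' e' where l: "l = (A *v d', s')" "C' \<ge> 0" "e' > 0"
      "\<And>\<epsilon>. 0 \<le> \<epsilon> \<Longrightarrow> \<epsilon> \<le> e' \<Longrightarrow> p + \<epsilon> *\<^sub>R d' \<in> X"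
      "\<And>\<epsilon>. 0 \<le> \<epsilon> \<Longrightarrow> \<epsilon> \<le> e' \<Longrightarrow> ?F (p + \<epsilon> *\<^sub>R d') \<le> ?F p + \<epsilon> * s' + C' * \<epsilon>\<^sup>2"
      by (rule descent_coneE) blast
    \<comment> \<open>A step \<open>\<epsilon>\<close> along \<open>d + d'\<close> is the midpoint
      of steps \<open>2 * \<epsilon>\<close> along \<open>d\<close> and \<open>d'\<close>. Hence the
      admissible range is halved, and the averaged errors become \<open>2 * (C + C')\<close> times
      the square of \<open>\<epsilon>\<close>.\<close>
    have mid: "p + \<epsilon> *\<^sub>R (d + d') = (1/2) *\<^sub>R ((p + (2 * \<epsilon>) *\<^sub>R d) + (p + (2 * \<epsilon>) *\<^sub>R d'))" for \<epsilon>
      by (simp add: vec_eq_iff algebra_simps)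
    have "(A *v (d + d'), s + s') \<in> descent_cone A \<tau> u X p"
    proof (rule descent_coneI[where C = "2 * (C + C')" and e = "min e e' / 2"])
      fix \<epsilon> :: real assume \<epsilon>: "0 \<le> \<epsilon>" "\<epsilon> \<le> min e e' / 2"
      then have \<epsilon>2: "0 \<le> 2 * \<epsilon>" "2 * \<epsilon> \<le> e" "2 * \<epsilon> \<le> e'" by auto
      show "p + \<epsilon> *\<^sub>R (d + d') \<in> X"
        using convexD[OF assms(2) k(4)[OF \<epsilon>2(1,2)] l(4)[OF \<epsilon>2(1,3)], of "1/2" "1/2"]
        unfolding mid by (simp only: scaleR_add_right)
      have "?F (p + \<epsilon> *\<^sub>R (d + d')) \<le> (?F (p + (2 * \<epsilon>) *\<^sub>R d) + ?F (p + (2 * \<epsilon>) *\<^sub>R d')) / 2"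
        unfolding mid by (rule primal_obj_midpoint[OF assms(1)])
      also have "\<dots> \<le> ((?F p + (2 * \<epsilon>) * s + C * (2 * \<epsilon>)\<^sup>2) + (?F p + (2 * \<epsilon>) * s' + C' * (2 * \<epsilon>)\<^sup>2)) / 2"
        by (intro divide_right_mono add_mono k(5) l(5) \<epsilon>2) simp
      also have "\<dots> = ?F p + \<epsilon> * (s + s') + 2 * (C + C') * \<epsilon>\<^sup>2"
        by (simp add: field_simps power2_eq_square)
      finally show "?F (p + \<epsilon> *\<^sub>R (d + d')) \<le> ?F p + \<epsilon> * (s + s') + 2 * (C + C') * \<epsilon>\<^sup>2" .
    qed (use k l in auto)
    then show ?thesis by (simp add: k l matrix_vector_right_distrib)
  qed
  show "c *\<^sub>R k \<in> descent_cone A \<tau> u X p"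
    if "k \<in> descent_cone A \<tau> u X p" "0 \<le> c" for k and c :: real
  proof (cases "c = 0")
    case True
    then show ?thesis using zero by simp
  next
    case False
    with that have c: "c > 0" by simp
    from that(1) obtain d s C e where k: "k = (A *v d, s)" "C \<ge> 0" "e > 0"
      "\<And>\<epsilon>. 0 \<le> \<epsilon> \<Longrightarrow> \<epsilon> \<le> e \<Longrightarrow> p + \<epsilon> *\<^sub>R d \<in> X"
      "\<And>\<epsilon>. 0 \<le> \<epsilon> \<Longrightarrow> \<epsilon> \<le> e \<Longrightarrow> ?F (p + \<epsilon> *\<^sub>R d) \<le> ?F p + \<epsilon> * s + C * \<epsilon>\<^sup>2"
      by (rule descent_coneE) blast
    \<comment> \<open>A step \<open>\<epsilon>\<close> along \<open>c d\<close> is a step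
      \<open>\<epsilon> * c\<close> along \<open>d\<close>, which dictates the rescaled error
      constant and range.\<close>
    have "(A *v (c *\<^sub>R d), c * s) \<in> descent_cone A \<tau> u X p"
    proof (rule descent_coneI[where C = "c\<^sup>2 * C" and e = "e / c"])
      fix \<epsilon> :: real assume \<epsilon>: "0 \<le> \<epsilon>" "\<epsilon> \<le> e / c"
      then have \<epsilon>c: "0 \<le> \<epsilon> * c" "\<epsilon> * c \<le> e" using c by (auto simp: field_simps)
      show "p + \<epsilon> *\<^sub>R c *\<^sub>R d \<in> X" using k(4)[OF \<epsilon>c] by simp
      show "?F (p + \<epsilon> *\<^sub>R c *\<^sub>R d) \<le> ?F p + \<epsilon> * (c * s) + c\<^sup>2 * C * \<epsilon>\<^sup>2"
        using k(5)[OF \<epsilon>c] by (simp add: power_mult_distrib mult_ac)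
    qed (use k c in auto)
    then show ?thesis by (simp add: k matrix_vector_mult_scaleR)
  qed
qed

text \<open>Such an element would come from a feasible direction in the kernel of \<open>A\<close>
  with slope \<open>-1\<close>; for short steps the linear decrease beats the quadratic
  error.\<close>

lemma minimizer_no_descent:
  assumes "is_arg_min (primal_obj \<tau> u) (\<lambda>z. A *v z = b \<and> z \<in> X) p"
  shows "(0, -1) \<notin> descent_cone A \<tau> u X p"
proof
  let ?F = "primal_obj \<tau> u"
  assume "(0, -1) \<in> descent_cone A \<tau> u X p"
  then obtain d s C e where k: "(0, -1) = (A *v d, s)" "C \<ge> 0" "e > 0"
    "\<And>\<epsilon>. 0 \<le> \<epsilon> \<Longrightarrow> \<epsilon> \<le> e \<Longrightarrow> p + \<epsilon> *\<^sub>R d \<in> X"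
    "\<And>\<epsilon>. 0 \<le> \<epsilon> \<Longrightarrow> \<epsilon> \<le> e \<Longrightarrow> ?F (p + \<epsilon> *\<^sub>R d) \<le> ?F p + \<epsilon> * s + C * \<epsilon>\<^sup>2"
    by (rule descent_coneE) blast
  \<comment> \<open>Short enough to be admissible and to give \<open>C * \<epsilon> < 1\<close>,
    whereas optimality will force \<open>1 \<le> C * \<epsilon>\<close>.\<close>
  define \<epsilon> where "\<epsilon> = min e (1 / (C + 1))"
  have \<epsilon>: "\<epsilon> > 0" "\<epsilon> \<le> e" "\<epsilon> \<le> 1 / (C + 1)" using k(2,3) by (auto simp: \<epsilon>_def)
  have "A *v (p + \<epsilon> *\<^sub>R d) = b"
    using k(1) assms by (auto simp: is_arg_min_def matrix_vector_right_distrib matrix_vector_mult_scaleR)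
  then have "?F p \<le> ?F (p + \<epsilon> *\<^sub>R d)"
    using assms k(4)[of \<epsilon>] \<epsilon> by (auto simp: is_arg_min_linorder)
  also have "\<dots> \<le> ?F p - \<epsilon> + C * \<epsilon>\<^sup>2" using k(1) k(5)[of \<epsilon>] \<epsilon> by auto
  finally have "\<epsilon> \<le> C * \<epsilon> * \<epsilon>" by (simp add: power2_eq_square mult.assoc)
  then have "1 \<le> C * \<epsilon>" using \<epsilon> by simp
  moreover have "(C + 1) * \<epsilon> \<le> 1" using \<epsilon>(3) k(2) by (simp add: field_simps)
  ultimately show False using \<epsilon> by (simp add: algebra_simps)
qed

text \<open>One-sided derivative of the absolute value at \<open>t\<close> in the direction \<open>\<sigma> \<in> {1, -1}\<close>.\<close>

definition abs_slope :: "real \<Rightarrow> real \<Rightarrow> real" where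
  "abs_slope \<sigma> t = (if t = 0 then 1 else \<sigma> * sgn t)"

text \<open>Along an axis the absolute value is affine until the coordinate reaches zero, and the
  quadratic term of the objective contributes exactly the allowed error.\<close>

lemma axis_direction_in_descent_cone:
  fixes A :: "real ^ 'n ^ 'm"
  assumes "\<tau> > 0" and conv: "\<And>i. convex (I i)" and p: "p \<in> box_of I"
    and \<sigma>: "\<sigma> \<in> {1, -1}" and t: "t \<in> I i" "\<sigma> * (t - p $ i) > 0"
  shows "(A *v axis i \<sigma>, abs_slope \<sigma> (p $ i) + \<sigma> * (p $ i - u $ i) / \<tau>)
    \<in> descent_cone A \<tau> u (box_of I) p"
proof -
  \<comment> \<open>The first bound keeps the moved coordinate between \<open>p $ i\<close> and
    \<open>t\<close>, hence in \<open>I i\<close>; the second keeps it from crossing zero. Starting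
    from zero no crossing occurs, and \<open>1\<close> is an arbitrary positive bound.\<close>
  define e where "e = min (\<sigma> * (t - p $ i)) (if p $ i = 0 then 1 else \<bar>p $ i\<bar>)"
  have upd: "\<bar>(p + \<epsilon> *\<^sub>R axis i \<sigma>) $ j\<bar> =
      \<bar>p $ j\<bar> + (if j = i then \<bar>p $ i + \<epsilon> * \<sigma>\<bar> - \<bar>p $ i\<bar> else 0)" for \<epsilon> j
    by (simp add: axis_def)
  have l1: "l1_norm (p + \<epsilon> *\<^sub>R axis i \<sigma>) = l1_norm p + (\<bar>p $ i + \<epsilon> * \<sigma>\<bar> - \<bar>p $ i\<bar>)" for \<epsilon>
    unfolding l1_norm_def upd sum.distrib by simp
  have ss: "\<sigma> * \<sigma> = 1" using \<sigma> by auto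
  have "p + \<epsilon> *\<^sub>R axis i \<sigma> - u = (p - u) + \<epsilon> *\<^sub>R axis i \<sigma>" for \<epsilon> by simp
  then have sq: "(norm (p + \<epsilon> *\<^sub>R axis i \<sigma> - u))\<^sup>2
      = (norm (p - u))\<^sup>2 + 2 * \<epsilon> * \<sigma> * (p $ i - u $ i) + \<epsilon>\<^sup>2" for \<epsilon>
    unfolding power2_norm_eq_inner
    by (simp add: inner_simps inner_axis inner_axis' ss algebra_simps power2_eq_square)
  show ?thesis
  proof (rule descent_coneI[where C = "1 / (2 * \<tau>)" and e = e])
    show "e > 0" using t by (simp add: e_def)
    fix \<epsilon> assume \<epsilon>: "0 \<le> \<epsilon>" "\<epsilon> \<le> e"
    have pI: "p $ j \<in> I j" for j using p by (simp add: box_of_def)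
    have int: "is_interval (I i)" using conv by (simp add: is_interval_convex_1)
    have le: "\<epsilon> \<le> \<sigma> * (t - p $ i)" using \<epsilon>(2) by (simp add: e_def)
    have "p $ i + \<epsilon> * \<sigma> \<in> I i"
    proof (cases "\<sigma> = 1")
      case True
      then show ?thesis
        using le \<epsilon>(1) by (intro mem_is_interval_1_I[OF int pI t(1)]) simp_all
    next
      case False
      with \<sigma> have "\<sigma> = -1" by simp
      then show ?thesis
        using le \<epsilon>(1) by (intro mem_is_interval_1_I[OF int t(1) pI]) simp_all
    qed
    then show "p + \<epsilon> *\<^sub>R axis i \<sigma> \<in> box_of I" using pI by (auto simp: box_of_def axis_def)
    have "\<bar>p $ i + \<epsilon> * \<sigma>\<bar> - \<bar>p $ i\<bar> = \<epsilon> * abs_slope \<sigma> (p $ i)"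
      using \<sigma> \<epsilon> unfolding abs_slope_def e_def by (auto simp: sgn_if split: if_splits)
    then show "primal_obj \<tau> u (p + \<epsilon> *\<^sub>R axis i \<sigma>) \<le> primal_obj \<tau> u p
        + \<epsilon> * (abs_slope \<sigma> (p $ i) + \<sigma> * (p $ i - u $ i) / \<tau>) + 1 / (2 * \<tau>) * \<epsilon>\<^sup>2"
      unfolding primal_obj_def l1 sq using assms(1) by (simp add: field_simps)
  qed (use assms(1) in auto)
qed

section \<open>Coordinatewise minimization of the Lagrangian over a box\<close>

lemma lagrangian_separable:
  fixes A :: "real ^ 'n ^ 'm"
  shows "lagrangian A b u \<tau> z y = y \<bullet> b
    + (\<Sum>i\<in>UNIV. \<bar>z $ i\<bar> + (z $ i - u $ i)\<^sup>2 / (2 * \<tau>) - (transpose A *v y) $ i * z $ i)"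
proof -
  have "y \<bullet> (A *v z) = (transpose A *v y) \<bullet> z"
    by (simp add: dot_lmul_matrix)
  also have "\<dots> = (\<Sum>i\<in>UNIV. (transpose A *v y) $ i * z $ i)"
    by (simp add: inner_vec_def del: transpose_matrix_vector)
  finally have "y \<bullet> (A *v z) = (\<Sum>i\<in>UNIV. (transpose A *v y) $ i * z $ i)" .
  moreover have "(norm (z - u))\<^sup>2 = (\<Sum>i\<in>UNIV. (z $ i - u $ i)\<^sup>2)"
    unfolding power2_norm_eq_inner inner_vec_def by (simp add: power2_eq_square)
  ultimately show ?thesis
    unfolding lagrangian_def l1_norm_def
    by (simp add: inner_diff_right sum.distrib sum_subtractf sum_divide_distrib
        del: transpose_matrix_vector)
qed

text \<open>For \<open>\<tau> > 0\<close> the Lagrangian is strongly convex in its primal argument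
  with modulus \<open>1 / \<tau>\<close>, so on a convex set every minimizer has this quadratic
  growth. It is built in because cocoercivity rests on it.\<close>

definition strong_minimizer ::
    "real ^ 'n ^ 'm \<Rightarrow> real ^ 'm \<Rightarrow> real ^ 'n \<Rightarrow> real \<Rightarrow> (real ^ 'n) set \<Rightarrow> real ^ 'm \<Rightarrow> real ^ 'n \<Rightarrow> bool" where
  "strong_minimizer A b u \<tau> X y p \<longleftrightarrow> p \<in> X \<and>
     (\<forall>z\<in>X. lagrangian A b u \<tau> p y + (norm (z - p))\<^sup>2 / (2 * \<tau>) \<le> lagrangian A b u \<tau> z y)"

text \<open>The slope condition says that the negative derivative of the smooth part is a
  subgradient at \<open>p $ i\<close> of the absolute value restricted to \<open>I i\<close>.
  Expanding the square around \<open>p $ i\<close> is exact and leaves the growth term as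
  remainder.\<close>

lemma strong_minimizer_box_ofI:
  assumes "\<tau> > 0" and p: "p \<in> box_of I"
    and slope: "\<And>i t. t \<in> I i \<Longrightarrow>
      \<bar>p $ i\<bar> + ((transpose A *v y) $ i - (p $ i - u $ i) / \<tau>) * (t - p $ i) \<le> \<bar>t\<bar>"
  shows "strong_minimizer A b u \<tau> (box_of I) y p"
  unfolding strong_minimizer_def
proof (intro conjI ballI p)
  fix z assume z: "z \<in> box_of I"
  have one: "(\<bar>p $ i\<bar> + (p $ i - u $ i)\<^sup>2 / (2 * \<tau>) - (transpose A *v y) $ i * p $ i)
      + (z $ i - p $ i)\<^sup>2 / (2 * \<tau>)
    \<le> \<bar>z $ i\<bar> + (z $ i - u $ i)\<^sup>2 / (2 * \<tau>) - (transpose A *v y) $ i * z $ i" for i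
  proof -
    have "(z $ i - u $ i)\<^sup>2 / (2 * \<tau>) - (p $ i - u $ i)\<^sup>2 / (2 * \<tau>) - (z $ i - p $ i)\<^sup>2 / (2 * \<tau>)
        - w * z $ i + w * p $ i = - ((w - (p $ i - u $ i) / \<tau>) * (z $ i - p $ i))" for w
      using assms(1) by (simp add: field_simps power2_eq_square)
    from this[of "(transpose A *v y) $ i"] slope[of "z $ i" i] z show ?thesis
      unfolding box_of_def mem_Collect_eq by (smt (verit))
  qed
  have "(norm (z - p))\<^sup>2 / (2 * \<tau>) = (\<Sum>i\<in>UNIV. (z $ i - p $ i)\<^sup>2 / (2 * \<tau>))"
    unfolding power2_norm_eq_inner inner_vec_def by (simp add: power2_eq_square sum_divide_distrib)
  then show "lagrangian A b u \<tau> p y + (norm (z - p))\<^sup>2 / (2 * \<tau>) \<le> lagrangian A b u \<tau> z y"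
    unfolding lagrangian_separable
    using sum_mono[where K = UNIV, OF one]
    by (simp add: sum.distrib del: transpose_matrix_vector)
qed

text \<open>Shrinking gives the coordinatewise unconstrained minimizer \<open>q\<close>; projecting
  onto the interval adds a normal-cone term, and the two together satisfy the subgradient condition
  at \<open>p\<close>.\<close>

lemma strong_minimizer_shrink:
  fixes A :: "real ^ 'n ^ 'm"
  assumes "\<tau> > 0" and I: "\<forall>i. I i \<in> T1 \<union> T2" and "box_of I \<noteq> {}"
    and p: "p = closest_point (box_of I) (\<tau> *\<^sub>R vshrink (inverse \<tau> *\<^sub>R u + transpose A *v y))"
  shows "strong_minimizer A b u \<tau> (box_of I) y p"
proof (rule strong_minimizer_box_ofI[OF assms(1)])
  note cc = closed_convex_box_of[OF I]
  define w where "w = transpose A *v y"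
  define q where "q = \<tau> *\<^sub>R vshrink (inverse \<tau> *\<^sub>R u + w)"
  show pX: "p \<in> box_of I" unfolding p by (rule closest_point_in_set[OF cc(1) assms(3)])
  fix i t assume t: "t \<in> I i"
  \<comment> \<open>Varying a single coordinate turns the variational inequality of the projection
    into a scalar one.\<close>
  have "p + axis i (t - p $ i) \<in> box_of I"
    using pX t by (auto simp: box_of_def axis_def)
  from closest_point_dot[OF cc(2,1) this, of q]
  have dot: "(q $ i - p $ i) * (t - p $ i) \<le> 0"
    using p by (simp add: q_def w_def inner_axis del: transpose_matrix_vector)
  \<comment> \<open>The residual \<open>s - shrink s\<close> is \<open>s\<close> clipped to
    \<open>[-1, 1]\<close>, so \<open>g\<close> is a subgradient of the absolute value at
    \<open>q $ i\<close>.\<close>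
  define g where "g = u $ i / \<tau> + w $ i - q $ i / \<tau>"
  have "q $ i = \<tau> * shrink (u $ i / \<tau> + w $ i)"
    by (simp add: q_def vshrink_def divide_inverse mult.commute)
  then have qs: "q $ i / \<tau> = shrink (u $ i / \<tau> + w $ i)" using assms(1) by simp
  have g1: "\<bar>g\<bar> \<le> 1" "q $ i / \<tau> > 0 \<longrightarrow> g = 1" "q $ i / \<tau> < 0 \<longrightarrow> g = -1"
    unfolding g_def qs shrink_def by (auto simp: sgn_if abs_if max_def)
  then have g: "\<bar>g\<bar> \<le> 1" "q $ i > 0 \<Longrightarrow> g = 1" "q $ i < 0 \<Longrightarrow> g = -1"
    using assms(1) by (auto simp: divide_simps)
  have gt: "g * s \<le> \<bar>s\<bar>" for s
  proof -
    have "g * s \<le> \<bar>g\<bar> * \<bar>s\<bar>" by (simp flip: abs_mult)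
    also have "\<dots> \<le> 1 * \<bar>s\<bar>" using g(1) by (rule mult_right_mono) simp
    finally show ?thesis by simp
  qed
  \<comment> \<open>\<open>g\<close> still works at \<open>p $ i\<close> towards points of
    \<open>I i\<close>: by \<open>dot\<close>, \<open>q $ i\<close> is not on the same side of
    \<open>p $ i\<close> as \<open>t\<close>. If moving to \<open>t\<close> initially reduces the
    absolute value, \<open>q $ i\<close> has the sign of \<open>p $ i\<close> and fixes
    \<open>g\<close>; otherwise \<open>\<bar>g\<bar> \<le> 1\<close> suffices.\<close>
  have sub: "\<bar>p $ i\<bar> + g * (t - p $ i) \<le> \<bar>t\<bar>"
  proof -
    consider "t = p $ i" | "t > p $ i" "q $ i \<le> p $ i" | "t < p $ i" "p $ i \<le> q $ i"
    proof (cases t "p $ i" rule: linorder_cases)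
      case less
      have "p $ i \<le> q $ i"
        using dot mult_neg_neg[of "q $ i - p $ i" "t - p $ i"] less by linarith
      with less that show ?thesis by blast
    next
      case greater
      have "q $ i \<le> p $ i"
        using dot mult_pos_pos[of "q $ i - p $ i" "t - p $ i"] greater by linarith
      with greater that show ?thesis by blast
    qed (rule that)
    then show ?thesis
    proof cases
      case 2
      have "\<bar>p $ i\<bar> + g * (t - p $ i) \<le> \<bar>t\<bar>" if "p $ i \<ge> 0"
        using 2 that gt[of "t - p $ i"] by linarith
      with 2 g(3) show ?thesis by (cases "p $ i < 0") auto
    next
      case 3
      have "\<bar>p $ i\<bar> + g * (t - p $ i) \<le> \<bar>t\<bar>" if "p $ i \<le> 0"
        using 3 that gt[of "t - p $ i"] by linarith
      with 3 g(2) show ?thesis by (cases "p $ i > 0") auto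
    qed simp
  qed
  \<comment> \<open>The required slope is \<open>g\<close> plus the normal-cone term
    \<open>(q $ i - p $ i) / \<tau>\<close>.\<close>
  have "(w $ i - (p $ i - u $ i) / \<tau>) * (t - p $ i)
      = g * (t - p $ i) + (q $ i - p $ i) * (t - p $ i) / \<tau>"
    unfolding g_def by (simp add: algebra_simps diff_divide_distrib add_divide_distrib)
  moreover have "(q $ i - p $ i) * (t - p $ i) / \<tau> \<le> 0"
    using dot assms(1) by (simp add: divide_nonpos_pos)
  ultimately show "\<bar>p $ i\<bar> + ((transpose A *v y) $ i - (p $ i - u $ i) / \<tau>) * (t - p $ i) \<le> \<bar>t\<bar>"
    using sub unfolding w_def by linarith
qed

section \<open>Existence of a Lagrange multiplier\<close>

text \<open>Only axis directions are separated from \<open>(0, -1)\<close>: on a box their one-sided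
  slope inequalities already give the coordinatewise optimality condition.\<close>

lemma lagrange_multiplier_exists:
  fixes A :: "real ^ 'n ^ 'm"
  assumes "\<tau> > 0" and conv: "\<And>i. convex (I i)"
    and min: "is_arg_min (primal_obj \<tau> u) (\<lambda>z. A *v z = b \<and> z \<in> box_of I) p"
  obtains y where "strong_minimizer A b u \<tau> (box_of I) y p"
proof -
  define slope where "slope \<sigma> i = abs_slope \<sigma> (p $ i) + \<sigma> * (p $ i - u $ i) / \<tau>" for \<sigma> i
  \<comment> \<open>A direction is included only if its coordinate can move that way inside
    \<open>I i\<close>.\<close>
  define G where "G = (\<lambda>(\<sigma>, i). (A *v axis i \<sigma>, slope \<sigma> i)) `
    {(\<sigma>, i). \<sigma> \<in> {1, -1} \<and> (\<exists>t\<in>I i. \<sigma> * (t - p $ i) > 0)}"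
  have p: "p \<in> box_of I" using min by (simp add: is_arg_min_def)
  have "box_of I = (\<Inter>i. (\<lambda>x. x $ i) -` I i)" by (auto simp: box_of_def)
  then have "convex (box_of I)"
    using conv by (auto simp: linear_iff intro!: convex_INT convex_linear_vimage)
  then have cone: "convex_cone (descent_cone A \<tau> u (box_of I) p)"
    by (rule convex_cone_descent_cone[OF assms(1) _ p])
  have "G \<subseteq> descent_cone A \<tau> u (box_of I) p"
    unfolding G_def slope_def
    by (rule image_subsetI, clarify, rule axis_direction_in_descent_cone[OF assms(1) conv p])
  then have "convex_cone hull G \<subseteq> descent_cone A \<tau> u (box_of I) p"
    using cone by (rule hull_minimal)
  then have notin: "(0, -1) \<notin> convex_cone hull G"
    using minimizer_no_descent[OF min] by blast
  have "finite ({1, -1 :: real} \<times> (UNIV :: 'n set))" by simp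
  then have "finite G"
    unfolding G_def by (intro finite_imageI) (erule rev_finite_subset, auto)
  from closed_convex_cone_hull[OF this] obtain a
    where a: "a \<bullet> (0, -1) < 0" "\<And>k. k \<in> convex_cone hull G \<Longrightarrow> 0 \<le> a \<bullet> k"
    using convex_cone_separation[OF convex_cone_convex_cone_hull _ notin] by metis
  obtain z r where zr: "a = (z, r)" by (cases a)
  \<comment> \<open>Separating the vertical vector \<open>(0, -1)\<close> makes the objective
    component positive, so it can be normalized to \<open>1\<close>. The minus sign in
    \<open>y\<close> matches the term \<open>- A *v x\<close> in the Lagrangian.\<close>
  have r: "r > 0" using a(1) by (simp add: zr)
  define y where "y = (- 1 / r) *\<^sub>R z"
  have multiplier: "\<sigma> * (transpose A *v y) $ i \<le> slope \<sigma> i"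
    if "\<sigma> \<in> {1, -1}" "t \<in> I i" "\<sigma> * (t - p $ i) > 0" for \<sigma> i t
  proof -
    have "(A *v axis i \<sigma>, slope \<sigma> i) \<in> G" unfolding G_def using that by force
    then have "0 \<le> z \<bullet> (A *v axis i \<sigma>) + r * slope \<sigma> i"
      using a(2)[OF hull_inc] by (fastforce simp: zr)
    moreover have "\<sigma> * (transpose A *v y) $ i = y \<bullet> (A *v axis i \<sigma>)"
      by (simp flip: dot_lmul_matrix add: inner_axis)
    moreover have "z = - r *\<^sub>R y" using r by (simp add: y_def)
    ultimately have "0 \<le> r * (slope \<sigma> i - \<sigma> * (transpose A *v y) $ i)"
      by (simp add: algebra_simps del: transpose_matrix_vector)
    then show ?thesis using r by (simp add: zero_le_mult_iff del: transpose_matrix_vector)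
  qed
  have "strong_minimizer A b u \<tau> (box_of I) y p"
  proof (rule strong_minimizer_box_ofI[OF assms(1) p])
    fix i t assume t: "t \<in> I i"
    define w where "w = (transpose A *v y) $ i"
    define v where "v = (p $ i - u $ i) / \<tau>"
    have mult: "\<sigma> * w \<le> abs_slope \<sigma> (p $ i) + \<sigma> * v" if "\<sigma> \<in> {1, -1}" "\<sigma> * (t - p $ i) > 0" for \<sigma>
      using multiplier[OF that(1) t that(2)] by (simp add: slope_def w_def v_def del: transpose_matrix_vector)
    \<comment> \<open>By convexity the absolute value lies above its one-sided tangent.\<close>
    have abs: "\<bar>p $ i\<bar> + abs_slope \<sigma> (p $ i) * (\<sigma> * (t - p $ i)) \<le> \<bar>t\<bar>"
      if "\<sigma> \<in> {1, -1}" "\<sigma> * (t - p $ i) > 0" for \<sigma>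
      using that by (auto simp: abs_slope_def sgn_if)
    have "\<bar>p $ i\<bar> + (w - v) * (t - p $ i) \<le> \<bar>t\<bar>"
    proof (cases "t = p $ i")
      case False
      define \<sigma> where "\<sigma> = sgn (t - p $ i)"
      have \<sigma>: "\<sigma> \<in> {1, -1}" "\<sigma> * (t - p $ i) > 0" using False by (auto simp: \<sigma>_def sgn_if)
      have "(w - v) * (t - p $ i) = (\<sigma> * w - \<sigma> * v) * (\<sigma> * (t - p $ i))" using \<sigma>(1) by auto
      also have "\<dots> \<le> abs_slope \<sigma> (p $ i) * (\<sigma> * (t - p $ i))"
        using mult[OF \<sigma>] \<sigma>(2) by (intro mult_right_mono) auto
      finally show ?thesis using abs[OF \<sigma>] by linarith
    qed simp
    then show "\<bar>p $ i\<bar> + ((transpose A *v y) $ i - (p $ i - u $ i) / \<tau>) * (t - p $ i) \<le> \<bar>t\<bar>"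
      by (simp only: w_def v_def)
  qed
  then show ?thesis by (rule that)
qed

section \<open>Dual optimality, cocoercivity and closedness of strong minimizers\<close>

text \<open>Weak duality: at the feasible \<open>p\<close> the Lagrangian does not depend on the
  multiplier, so its value bounds every dual value, and \<open>y\<close> attains it.\<close>

lemma strong_minimizer_dual_solution:
  assumes "\<tau> > 0" "strong_minimizer A b u \<tau> X y p" "A *v p = b" "closed X" "convex X"
  shows "y \<in> dual_solutions A b u \<tau> X"
proof -
  have min: "lagrangian A b u \<tau> p y \<le> lagrangian A b u \<tau> z y" if "z \<in> X" for z
  proof -
    have "(norm (z - p))\<^sup>2 / (2 * \<tau>) \<ge> 0" using assms(1) by simp
    with assms(2) that show ?thesis unfolding strong_minimizer_def by fastforce
  qed
  have pX: "p \<in> X" using assms(2) by (simp add: strong_minimizer_def)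
  have "dual_fun A b u \<tau> X y = lagrangian A b u \<tau> p y"
    unfolding dual_fun_def by (rule cInf_eq_minimum) (use min pX in auto)
  moreover have "dual_fun A b u \<tau> X z \<le> lagrangian A b u \<tau> p y" for z
  proof -
    have "dual_fun A b u \<tau> X z \<le> lagrangian A b u \<tau> p z"
      using dual_fun_attained[OF assms(1,4,5), of A b u z] pX by (metis empty_iff)
    also have "\<dots> = lagrangian A b u \<tau> p y"
      using assms(3) by (simp add: lagrangian_def)
    finally show ?thesis .
  qed
  ultimately show ?thesis by (simp add: dual_solutions_def)
qed

text \<open>Test each growth inequality at the other minimizer and add; the objective terms cancel
  and only the multiplier terms survive.\<close>

lemma strong_minimizer_cocoercive:
  assumes "\<tau> > 0" "strong_minimizer A b u \<tau> X y p" "strong_minimizer A b u \<tau> X y' p'"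
  shows "(norm (p - p'))\<^sup>2 \<le> \<tau> * ((y - y') \<bullet> (A *v (p - p')))"
proof -
  have "lagrangian A b u \<tau> p y + (norm (p' - p))\<^sup>2 / (2 * \<tau>) \<le> lagrangian A b u \<tau> p' y"
    "lagrangian A b u \<tau> p' y' + (norm (p - p'))\<^sup>2 / (2 * \<tau>) \<le> lagrangian A b u \<tau> p y'"
    using assms(2,3) by (auto simp: strong_minimizer_def)
  then have "2 * ((norm (p - p'))\<^sup>2 / (2 * \<tau>)) \<le> (y - y') \<bullet> (A *v (p - p'))"
    unfolding lagrangian_def norm_minus_commute[of p' p]
    by (simp add: inner_simps matrix_vector_mult_diff_distrib)
  then show ?thesis using assms(1) by (simp add: field_simps)
qed

lemma strong_minimizer_limit:
  fixes A :: "real ^ 'n ^ 'm"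
  assumes lim: "p \<longlonglongrightarrow> p'" "y \<longlonglongrightarrow> y'" and "p' \<in> X"
    and min: "\<And>k. strong_minimizer A b u \<tau> X (y k) (p k)"
  shows "strong_minimizer A b u \<tau> X y' p'"
  unfolding strong_minimizer_def
proof (intro conjI ballI \<open>p' \<in> X\<close>)
  fix z assume "z \<in> X"
  have A: "(\<lambda>k. A *v p k) \<longlonglongrightarrow> A *v p'"
    using lim(1) by (rule bounded_linear.tendsto[OF matrix_vector_mul_bounded_linear])
  have "(\<lambda>k. lagrangian A b u \<tau> (p k) (y k) + (norm (z - p k))\<^sup>2 / (2 * \<tau>))
      \<longlonglongrightarrow> lagrangian A b u \<tau> p' y' + (norm (z - p'))\<^sup>2 / (2 * \<tau>)"
    unfolding lagrangian_def l1_norm_def divide_inverse by (intro tendsto_intros lim A)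
  moreover have "(\<lambda>k. lagrangian A b u \<tau> z (y k)) \<longlonglongrightarrow> lagrangian A b u \<tau> z y'"
    unfolding lagrangian_def by (intro tendsto_intros lim)
  ultimately show "lagrangian A b u \<tau> p' y' + (norm (z - p'))\<^sup>2 / (2 * \<tau>) \<le> lagrangian A b u \<tau> z y'"
    using min \<open>z \<in> X\<close> by (intro LIMSEQ_le) (auto simp: strong_minimizer_def)
qed

section \<open>Convergence criteria for sequences\<close>

text \<open>Boundedness gives a cluster point \<open>l\<close>. As \<open>l\<close> is in
  \<open>S\<close>, the distance to it is monotone, and a subsequence of these distances tends to
  zero, so all of them do.\<close>

lemma fejer_monotone_convergent:
  fixes y :: "nat \<Rightarrow> 'a::euclidean_space"
  assumes "S \<noteq> {}" and fejer: "\<And>z k. z \<in> S \<Longrightarrow> dist (y (Suc k)) z \<le> dist (y k) z"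
    and cluster: "\<And>r l. strict_mono r \<Longrightarrow> (y \<circ> r) \<longlonglongrightarrow> l \<Longrightarrow> l \<in> S"
  obtains l where "l \<in> S" "y \<longlonglongrightarrow> l"
proof -
  have dec: "decseq (\<lambda>k. dist (y k) z)" if "z \<in> S" for z
    using fejer[OF that] by (simp add: decseq_Suc_iff)
  obtain z where z: "z \<in> S" using assms(1) by blast
  have "y k \<in> cball z (dist (y 0) z)" for k
    using decseqD[OF dec[OF z], of 0 k] by (simp add: dist_commute)
  then obtain l r where r: "strict_mono r" "(y \<circ> r) \<longlonglongrightarrow> l"
    using compact_cball[of z "dist (y 0) z"] unfolding compact_def by metis
  have l: "l \<in> S" using cluster[OF r] .
  have "Bseq (\<lambda>k. dist (y k) l)"
    using decseqD[OF dec[OF l], of 0] by (intro BseqI'[of _ "dist (y 0) l"]) auto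
  then obtain L where L: "(\<lambda>k. dist (y k) l) \<longlonglongrightarrow> L"
    using Bseq_monoseq_convergent[OF _ decseq_imp_monoseq[OF dec[OF l]]] by (auto simp: convergent_def)
  have "((\<lambda>k. dist (y k) l) \<circ> r) \<longlonglongrightarrow> L" by (rule LIMSEQ_subseq_LIMSEQ[OF L r(1)])
  moreover have "((\<lambda>k. dist (y k) l) \<circ> r) \<longlonglongrightarrow> 0"
    using r(2) unfolding tendsto_dist_iff[of "y \<circ> r"] by (simp add: o_def)
  ultimately have "L = 0" by (rule LIMSEQ_unique)
  then have "y \<longlonglongrightarrow> l" using L by (simp add: tendsto_dist_iff[of y])
  with l show ?thesis by (rule that)
qed

text \<open>The sequence \<open>a\<close> is decreasing and bounded below, so its decrements vanish,
  and they dominate \<open>c * s k\<close>.\<close>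

lemma nonneg_decrement_tendsto_zero:
  fixes a s :: "nat \<Rightarrow> real"
  assumes "c > 0" "\<And>k. a k \<ge> 0" "\<And>k. s k \<ge> 0" "\<And>k. a (Suc k) + c * s k \<le> a k"
  shows "s \<longlonglongrightarrow> 0"
proof -
  have step: "a (Suc k) \<le> a k" for k
    using assms(4)[of k] mult_nonneg_nonneg[of c "s k"] assms(1) assms(3)[of k] by linarith
  then obtain L where L: "a \<longlonglongrightarrow> L"
    using decseq_convergent[of a 0] assms(2) unfolding decseq_Suc_iff by blast
  have "(\<lambda>k. (a k - a (Suc k)) / c) \<longlonglongrightarrow> (L - L) / c"
    using assms(1) by (intro tendsto_intros L LIMSEQ_Suc) auto
  then have lim: "(\<lambda>k. (a k - a (Suc k)) / c) \<longlonglongrightarrow> 0" by simp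
  have "s k \<le> (a k - a (Suc k)) / c" for k
    using assms(1) assms(4)[of k] by (simp add: field_simps)
  then show ?thesis
    using assms(3) by (intro tendsto_sandwich[OF _ _ tendsto_const lim]) auto
qed

section \<open>Convergence of the iteration\<close>

theorem theorem1:
  fixes A :: "real ^ 'n ^ 'm" and b :: "real ^ 'm" and u :: "real ^ 'n"
    and \<tau> h :: real and I :: "'n \<Rightarrow> real set" and X :: "(real ^ 'n) set"
    and x :: "nat \<Rightarrow> real ^ 'n" and y :: "nat \<Rightarrow> real ^ 'm" and xstar :: "real ^ 'n"
  assumes "\<tau> > 0"
    and "\<forall>i. I i \<in> T1 \<union> T2"
    and "X = box_of I"
    and "X \<inter> {z. A *v z = b} \<noteq> {}"
    and "h > 0"
    \<comment> \<open>for \<open>A = 0\<close> the upper end of the step size interval is read as infinite\<close>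
    and "A \<noteq> 0 \<longrightarrow> h < 2 / (\<tau> * (onorm (\<lambda>v. A *v v))\<^sup>2)"
    and "y 0 = 0"
    and "\<forall>k. x (Suc k) =
           closest_point X (\<tau> *\<^sub>R vshrink (inverse \<tau> *\<^sub>R u + transpose A *v y k))"
    and "\<forall>k. y (Suc k) = y k + h *\<^sub>R (b - A *v x (Suc k))"
    and "is_arg_min (primal_obj \<tau> u) (\<lambda>z. A *v z = b \<and> z \<in> X) xstar"
  shows "x \<longlonglongrightarrow> xstar \<and> (\<exists>ybar \<in> dual_solutions A b u \<tau> X. y \<longlonglongrightarrow> ybar)"
proof -
  define K where "K = onorm (\<lambda>v. A *v v)"
  define c where "c = 2 * h / \<tau> - h\<^sup>2 * K\<^sup>2"
  have step: "x (Suc k) = closest_point X (\<tau> *\<^sub>R vshrink (inverse \<tau> *\<^sub>R u + transpose A *v y k))"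
    "y (Suc k) = y k + h *\<^sub>R (b - A *v x (Suc k))" for k
    using assms(8,9) by blast+
  have xstar: "A *v xstar = b" "xstar \<in> X" using assms(10) by (auto simp: is_arg_min_def)
  have cc: "closed X" "convex X" using closed_convex_box_of[OF assms(2)] assms(3) by auto
  have K: "norm (A *v v) \<le> K * norm v" for v
    unfolding K_def by (rule onorm[OF matrix_vector_mul_bounded_linear])
  have "c > 0"
  \<comment> \<open>The step size bound divides by the square of \<open>K\<close>. For
    \<open>K = 0\<close>, the case \<open>A = 0\<close>, the constant is simply
    \<open>2 * h / \<tau>\<close>.\<close>
  proof (cases "K = 0")
    case True
    then show ?thesis using assms(1,5) by (simp add: c_def)
  next
    case False
    have "K = 0" if "A = 0"
      unfolding K_def that matrix_vector_mult_0 by (rule onorm_zero)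
    with False have "A \<noteq> 0" by blast
    then have "h * (\<tau> * K\<^sup>2) < 2"
      using assms(1,6) False by (simp add: K_def field_simps)
    then have "h * (h * (\<tau> * K\<^sup>2)) < h * 2" using assms(5) by (rule mult_strict_left_mono)
    then show ?thesis using assms(1) by (simp add: c_def field_simps power2_eq_square)
  qed
  \<comment> \<open>Fejer monotonicity is shown relative to the multipliers of \<open>xstar\<close>;
    by strong duality they are dual solutions.\<close>
  define S where "S = {z. strong_minimizer A b u \<tau> X z xstar}"
  \<comment> \<open>Mind the shift: \<open>y k\<close> is paired with
    \<open>x (Suc k)\<close>.\<close>
  have min: "strong_minimizer A b u \<tau> X (y k) (x (Suc k))" for k
    unfolding assms(3)
    by (rule strong_minimizer_shrink[OF assms(1,2) _ step(1)[unfolded assms(3)]])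
      (use xstar assms(3) in auto)
  have conv: "convex (I i)" for i
    using assms(2)[rule_format, of i] by (auto simp: T1_def T2_def convex_real_interval)
  obtain yhat where yhat: "yhat \<in> S"
    using lagrange_multiplier_exists[OF assms(1) conv assms(10)[unfolded assms(3)]]
    unfolding S_def assms(3) by blast
  have fejer: "(norm (y (Suc k) - z))\<^sup>2 + c * (norm (x (Suc k) - xstar))\<^sup>2 \<le> (norm (y k - z))\<^sup>2"
    if "z \<in> S" for z k
  proof -
    define d where "d = x (Suc k) - xstar"
    have expand: "(norm (p - h *\<^sub>R q))\<^sup>2 = (norm p)\<^sup>2 - 2 * h * (p \<bullet> q) + h\<^sup>2 * (norm q)\<^sup>2"
      for p q :: "real ^ 'm"
      unfolding power2_norm_eq_inner
      by (simp add: inner_simps inner_commute algebra_simps power2_eq_square)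
    \<comment> \<open>Since \<open>b = A *v xstar\<close>, the residual is
      \<open>- (A *v d)\<close>.\<close>
    have "y (Suc k) - z = (y k - z) - h *\<^sub>R (A *v d)"
      using xstar(1) by (simp add: step(2) d_def matrix_vector_mult_diff_distrib algebra_simps)
    then have "(norm (y (Suc k) - z))\<^sup>2
        = (norm (y k - z))\<^sup>2 - 2 * h * ((y k - z) \<bullet> (A *v d)) + h\<^sup>2 * (norm (A *v d))\<^sup>2"
      by (simp only: expand)
    moreover have "2 * h * ((y k - z) \<bullet> (A *v d)) \<ge> 2 * h / \<tau> * (norm d)\<^sup>2"
    proof -
      \<comment> \<open>Cocoercivity for the pairs \<open>(y k, x (Suc k))\<close> and
        \<open>(z, xstar)\<close>.\<close>
      have "(norm d)\<^sup>2 \<le> \<tau> * ((y k - z) \<bullet> (A *v d))"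
        using strong_minimizer_cocoercive[OF assms(1) min] that unfolding S_def d_def by blast
      then have "(2 * h / \<tau>) * (norm d)\<^sup>2 \<le> (2 * h / \<tau>) * (\<tau> * ((y k - z) \<bullet> (A *v d)))"
        using assms(1,5) by (intro mult_left_mono) auto
      then show ?thesis using assms(1) by simp
    qed
    moreover have "h\<^sup>2 * (norm (A *v d))\<^sup>2 \<le> h\<^sup>2 * (K\<^sup>2 * (norm d)\<^sup>2)"
      using K[of d] unfolding power_mult_distrib[symmetric, of K]
      by (intro mult_left_mono power_mono) auto
    ultimately show ?thesis unfolding c_def d_def[symmetric] by (simp add: algebra_simps)
  qed
  have "(\<lambda>k. (norm (x (Suc k) - xstar))\<^sup>2) \<longlonglongrightarrow> 0"
    using fejer[OF yhat]
    by (intro nonneg_decrement_tendsto_zero[OF \<open>c > 0\<close>, where a = "\<lambda>k. (norm (y k - yhat))\<^sup>2"]) auto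
  then have "(\<lambda>k. norm (x (Suc k) - xstar)) \<longlonglongrightarrow> 0"
    using tendsto_real_sqrt by fastforce
  then have xlim: "(\<lambda>k. x (Suc k)) \<longlonglongrightarrow> xstar"
    by (simp add: tendsto_norm_zero_iff LIM_zero_iff)
  have "dist (y (Suc k)) z \<le> dist (y k) z" if "z \<in> S" for z k
  proof -
    have "c * (norm (x (Suc k) - xstar))\<^sup>2 \<ge> 0" using \<open>c > 0\<close> by simp
    with fejer[OF that, of k] have "(norm (y (Suc k) - z))\<^sup>2 \<le> (norm (y k - z))\<^sup>2" by linarith
    then show ?thesis unfolding dist_norm by (rule power2_le_imp_le) simp
  qed
  \<comment> \<open>Along the subsequence the primal iterates already tend to \<open>xstar\<close>,
    so the growth inequalities pass to the limit pair \<open>(l, xstar)\<close>.\<close>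
  moreover have "l \<in> S" if r: "strict_mono r" "(y \<circ> r) \<longlonglongrightarrow> l" for r l
  proof -
    have "((\<lambda>k. x (Suc k)) \<circ> r) \<longlonglongrightarrow> xstar" by (rule LIMSEQ_subseq_LIMSEQ[OF xlim r(1)])
    from strong_minimizer_limit[OF this r(2) xstar(2)] min show ?thesis by (simp add: S_def)
  qed
  ultimately obtain l where l: "l \<in> S" "y \<longlonglongrightarrow> l"
    using fejer_monotone_convergent[of S y] yhat by blast
  have "l \<in> dual_solutions A b u \<tau> X"
    using l(1) strong_minimizer_dual_solution[OF assms(1) _ xstar(1) cc] by (simp add: S_def)
  with l(2) LIMSEQ_imp_Suc[OF xlim] show ?thesis by blast
qed

end
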